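(* Let $\mathbb{K}$ be a field of characteristic different from $2$, and let $A=(V,\mu)$ be a $2$-dimensional $\mathbb{K}$-algebra that is not commutative. (1) If $\mathbb{K}$ is algebraically closed, then $A$ is isomorphic to an algebra with basis $\{e_1,e_2\}$ whose multiplication is one of the following, for some values of the parameters $\alpha_i,\beta_i\in\mathbb{K}$ (writing $e_ie_j$ for the product of $e_i$ and $e_j$): - $\mu^1_{\alpha_2,\beta_2,\alpha_4,\beta_4}$: $e_1e_1=e_2$, $e_1e_2=(\alpha_2+1)e_1+\beta_2e_2$, $e_2e_1=(\alpha_2-1)e_1+\beta_2e_2$, $e_2e_2=\alpha_4e_1+\beta_4e_2$; - $\mu^2_{\alpha_1,\alpha_2,\alpha_4}$: $e_1e_1=\alpha_1e_1$, $e_1e_2=(\alpha_2+1)e_1+e_2$, $e_2e_1=(\alpha_2-1)e_1+e_2$, $e_2e_2=\alpha_4e_1$; - $\mu^3_{\alpha_4,\beta_4}$: $e_1e_1=e_1$, $e_1e_2=e_1$, $e_2e_1=-e_1$, $e_2e_2=\alpha_4e_1+\beta_4e_2$; - $\mu^4_{\alpha_2,\beta_4}$: $e_1e_1=0$, $e_1e_2=(\alpha_2+1)e_1$, $e_2e_1=(\alpha_2-1)e_1$, $e_2e_2=\beta_4e_2$; - $\mu^5_{\alpha_2}$: $e_1e_1=0$, $e_1e_2=(\alpha_2+1)e_1$, $e_2e_1=(\alpha_2-1)e_1$, $e_2e_2=e_1+2\alpha_2e_2$. (2) If $\mathbb{K}$ is not algebraically closed, then $A$ is isomorphic to an algebra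 with multiplication $\mu^2_{\alpha_1,\alpha_2,\alpha_4}$, $\mu^3_{\alpha_4,\beta_4}$, $\mu^4_{\alpha_2,\beta_4}$ or $\mu^5_{\alpha_2}$ as in (1), or - $\varphi^{1,\lambda}_{\alpha_2,\beta_2,\alpha_4,\beta_4}$: $e_1e_1=\lambda e_2$, $e_1e_2=(\alpha_2+1)e_1+\beta_2e_2$, $e_2e_1=(\alpha_2-1)e_1+\beta_2e_2$, $e_2e_2=\alpha_4e_1+\beta_4e_2$, for some $\alpha_i,\beta_i\in\mathbb{K}$ and $\lambda\in\mathbb{K}/(\mathbb{K}^* )^2$.
   Context: A $\mathbb{K}$-algebra is a $\mathbb{K}$-vector space $V$ with an arbitrary bilinear multiplication $\mu:V\times V\to V$ (no associativity or unit is assumed). Two algebras $(V,\mu)$ and $(V',\mu')$ are isomorphic if there is a linear isomorphism $f:V\to V'$ with $f(\mu(X,Y))=\mu'(f(X),f(Y))$ for all $X,Y\in V$. The notation $\lambda\in\mathbb{K}/(\mathbb{K}^* )^2$ means that $\lambda$ is taken in a fixed set of representatives of the orbits of $\mathbb{K}$ under multiplication by the group $(\mathbb{K}^* )^2=\{a^2: a\in\mathbb{K}^*\}$ of nonzero squares. *)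

theory Defs
  imports "HOL-Analysis.Analysis" "HOL-Computational_Algebra.Polynomial"
begin

section \<open>Not necessarily associative algebras\<close>

locale nonassoc_algebra = vector_space scl
  for scl :: "'k::field \<Rightarrow> 'v::ab_group_add \<Rightarrow> 'v" +
  fixes \<mu> :: "'v \<Rightarrow> 'v \<Rightarrow> 'v"
  assumes linear_right: "Vector_Spaces.linear scl scl (\<lambda>y. \<mu> x y)"
    and linear_left: "Vector_Spaces.linear scl scl (\<lambda>x. \<mu> x y)"

definition nonassoc_algebra_isomorphic ::
  "('k::field \<Rightarrow> 'v::ab_group_add \<Rightarrow> 'v) \<Rightarrow> ('v \<Rightarrow> 'v \<Rightarrow> 'v) \<Rightarrow>
   ('k \<Rightarrow> 'w::ab_group_add \<Rightarrow> 'w) \<Rightarrow> ('w \<Rightarrow> 'w \<Rightarrow> 'w) \<Rightarrow> bool" where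
  "nonassoc_algebra_isomorphic scl \<mu> scl' \<mu>' \<longleftrightarrow>
     (\<exists>f. Vector_Spaces.linear scl scl' f \<and> bij f \<and>
          (\<forall>x y. f (\<mu> x y) = \<mu>' (f x) (f y)))"

section \<open>Hypotheses on the base field\<close>

text \<open>The library has algebraic closedness of a type only as the type class
  \<^class>\<open>alg_closed_field\<close>; a predicate is needed to speak about both cases for one field.
  The two lemmas below show that it agrees with the class.\<close>

definition algebraically_closed_type :: "'k::field itself \<Rightarrow> bool" where
  "algebraically_closed_type _ \<longleftrightarrow> (\<forall>p :: 'k poly. degree p > 0 \<longrightarrow> (\<exists>x. poly p x = 0))"

lemma algebraically_closed_type_alg_closed_field:
  "algebraically_closed_type TYPE('k::alg_closed_field)"
  unfolding algebraically_closed_type_def using alg_closed_imp_poly_has_root by blast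

lemma algebraically_closed_type_imp_OFCLASS:
  assumes "algebraically_closed_type TYPE('k::field)"
  shows "OFCLASS('k, alg_closed_field_class)"
proof (rule alg_closedI)
  fix p :: "'k poly"
  assume "degree p > 0"
  then show "\<exists>x. poly p x = 0"
    using assms unfolding algebraically_closed_type_def by blast
qed

definition square_orbit :: "'k::field \<Rightarrow> 'k set" where
  "square_orbit x = {a\<^sup>2 * x | a. a \<noteq> 0}"

text \<open>The orbit \<open>{0}\<close> is included, so every such set of representatives contains \<open>0\<close>.\<close>

definition square_orbit_representatives :: "'k::field set \<Rightarrow> bool" where
  "square_orbit_representatives R \<longleftrightarrow> (\<forall>T \<in> range square_orbit. \<exists>!r. r \<in> R \<and> r \<in> T)"

section \<open>Two-dimensional algebras given by a multiplication table\<close>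

abbreviation e1 :: "'k::field ^ 2" where "e1 \<equiv> axis 1 1"
abbreviation e2 :: "'k::field ^ 2" where "e2 \<equiv> axis 2 1"

text \<open>The bilinear multiplication on \<open>'k ^ 2\<close> with \<open>e\<^sub>i e\<^sub>j = eij\<close>.\<close>

definition table_mult ::
  "'k::field ^ 2 \<Rightarrow> 'k ^ 2 \<Rightarrow> 'k ^ 2 \<Rightarrow> 'k ^ 2 \<Rightarrow> 'k ^ 2 \<Rightarrow> 'k ^ 2 \<Rightarrow> 'k ^ 2" where
  "table_mult e11 e12 e21 e22 x y =
     (x $ 1 * y $ 1) *s e11 + (x $ 1 * y $ 2) *s e12 +
     (x $ 2 * y $ 1) *s e21 + (x $ 2 * y $ 2) *s e22"

lemma table_mult_basis:
  "table_mult e11 e12 e21 e22 e1 e1 = e11"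
  "table_mult e11 e12 e21 e22 e1 e2 = e12"
  "table_mult e11 e12 e21 e22 e2 e1 = e21"
  "table_mult e11 e12 e21 e22 e2 e2 = e22"
  by (simp_all add: table_mult_def axis_def)

lemma nonassoc_algebra_table_mult: "nonassoc_algebra (*s) (table_mult e11 e12 e21 e22)"
  by unfold_locales
    (simp_all add: table_mult_def vec_eq_iff algebra_simps)

definition mu1 :: "'k::field \<Rightarrow> 'k \<Rightarrow> 'k \<Rightarrow> 'k \<Rightarrow> 'k ^ 2 \<Rightarrow> 'k ^ 2 \<Rightarrow> 'k ^ 2" where
  "mu1 \<alpha>2 \<beta>2 \<alpha>4 \<beta>4 = table_mult
     e2
     ((\<alpha>2 + 1) *s e1 + \<beta>2 *s e2)
     ((\<alpha>2 - 1) *s e1 + \<beta>2 *s e2)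
     (\<alpha>4 *s e1 + \<beta>4 *s e2)"

definition mu2 :: "'k::field \<Rightarrow> 'k \<Rightarrow> 'k \<Rightarrow> 'k ^ 2 \<Rightarrow> 'k ^ 2 \<Rightarrow> 'k ^ 2" where
  "mu2 \<alpha>1 \<alpha>2 \<alpha>4 = table_mult
     (\<alpha>1 *s e1)
     ((\<alpha>2 + 1) *s e1 + e2)
     ((\<alpha>2 - 1) *s e1 + e2)
     (\<alpha>4 *s e1)"

definition mu3 :: "'k::field \<Rightarrow> 'k \<Rightarrow> 'k ^ 2 \<Rightarrow> 'k ^ 2 \<Rightarrow> 'k ^ 2" where
  "mu3 \<alpha>4 \<beta>4 = table_mult
     e1
     e1
     (- e1)
     (\<alpha>4 *s e1 + \<beta>4 *s e2)"

definition mu4 :: "'k::field \<Rightarrow> 'k \<Rightarrow> 'k ^ 2 \<Rightarrow> 'k ^ 2 \<Rightarrow> 'k ^ 2" where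
  "mu4 \<alpha>2 \<beta>4 = table_mult
     0
     ((\<alpha>2 + 1) *s e1)
     ((\<alpha>2 - 1) *s e1)
     (\<beta>4 *s e2)"

definition mu5 :: "'k::field \<Rightarrow> 'k ^ 2 \<Rightarrow> 'k ^ 2 \<Rightarrow> 'k ^ 2" where
  "mu5 \<alpha>2 = table_mult
     0
     ((\<alpha>2 + 1) *s e1)
     ((\<alpha>2 - 1) *s e1)
     (e1 + (2 * \<alpha>2) *s e2)"

definition phi1 :: "'k::field \<Rightarrow> 'k \<Rightarrow> 'k \<Rightarrow> 'k \<Rightarrow> 'k \<Rightarrow> 'k ^ 2 \<Rightarrow> 'k ^ 2 \<Rightarrow> 'k ^ 2" where
  "phi1 lam \<alpha>2 \<beta>2 \<alpha>4 \<beta>4 = table_mult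
     (lam *s e2)
     ((\<alpha>2 + 1) *s e1 + \<beta>2 *s e2)
     ((\<alpha>2 - 1) *s e1 + \<beta>2 *s e2)
     (\<alpha>4 *s e1 + \<beta>4 *s e2)"

end

theory Submission
  imports Defs
begin

text \<open>
  The commutator is an alternating bilinear map on a plane, so its values span a line. If \<open>u\<close> spans
  this line and \<open>v\<close> is a suitable multiple of any vector off it, then \<open>uv - vu = 2u\<close>. The bases with
  this property are related by \<open>u' = au\<close>, \<open>v' = v + bu\<close> with \<open>a \<noteq> 0\<close>, and \<open>a\<close> and \<open>b\<close> are chosen
  to simplify the commutative part of the product.
\<close>

context nonassoc_algebra
begin

section \<open>Ordered bases of the plane and multiplication tables\<close>

lemma mult_bilinear:
  "\<mu> (x + y) z = \<mu> x z + \<mu> y z" "\<mu> z (x + y) = \<mu> z x + \<mu> z y"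
  "\<mu> (scl c x) z = scl c (\<mu> x z)" "\<mu> z (scl c x) = scl c (\<mu> z x)"
proof -
  have left: "module_hom scl scl (\<lambda>x. \<mu> x z)" and right: "module_hom scl scl (\<mu> z)"
    using linear_left linear_right by (simp_all add: linear_iff_module_hom)
  show "\<mu> (x + y) z = \<mu> x z + \<mu> y z" "\<mu> z (x + y) = \<mu> z x + \<mu> z y"
    "\<mu> (scl c x) z = scl c (\<mu> x z)" "\<mu> z (scl c x) = scl c (\<mu> z x)"
    by (rule left[THEN module_hom.add] right[THEN module_hom.add]
        left[THEN module_hom.scale] right[THEN module_hom.scale])+
qed

text \<open>An ordered basis, phrased through coordinates because everything later compares
  coordinates of products.\<close>

definition is_frame :: "'v \<Rightarrow> 'v \<Rightarrow> bool" where
  "is_frame u v \<longleftrightarrow> (\<forall>w. \<exists>a b. w = scl a u + scl b v) \<and>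
     (\<forall>a b. scl a u + scl b v = 0 \<longrightarrow> a = 0 \<and> b = 0)"

lemma frame_exists:
  assumes "dim UNIV = 2"
  obtains u v where "is_frame u v"
proof -
  obtain B where B: "independent B" "UNIV \<subseteq> span B" "card B = dim UNIV"
    using basis_exists[of UNIV] by metis
  with assms obtain u v where uv: "B = {u, v}" "u \<noteq> v"
    by (metis card_2_iff)
  have "\<exists>a b. w = scl a u + scl b v" for w
  proof -
    have "w \<in> span {u, v}" using B uv by auto
    then obtain a b where "w - scl a u = scl b v"
      unfolding span_insert span_singleton by auto
    then have "w = scl a u + scl b v" by (simp add: algebra_simps)
    then show ?thesis by blast
  qed
  moreover have "a = 0 \<and> b = 0" if "scl a u + scl b v = 0" for a b
  proof -
    \<comment> \<open>The relation is rewritten as a sum over \<open>B\<close>; the case distinction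
      is a valid coefficient function because \<open>u\<close> and \<open>v\<close> differ.\<close>
    have "(\<Sum>x\<in>B. scl (if x = u then a else b) x) = 0" using uv that by simp
    moreover have "finite B" using uv by simp
    ultimately have "(if x = u then a else b) = 0" if "x \<in> B" for x
      using independentD[OF B(1), of B "\<lambda>x. if x = u then a else b" x] that by simp
    from this[of u] this[of v] show ?thesis using uv by auto
  qed
  ultimately have "is_frame u v" by (simp add: is_frame_def)
  then show ?thesis by (rule that)
qed

lemma comb_comb:
  "scl x (scl p u + scl q v) + scl y (scl r u + scl s v) =
     scl (x * p + y * r) u + scl (x * q + y * s) v"
  by (simp add: algebra_simps)

text \<open>An invertible coefficient matrix carries bases to bases; \<open>comb_comb\<close>
  reduces both halves to a 2x2 linear system.\<close>

lemma frame_change: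
  assumes uv: "is_frame u v" and det: "p * s - q * r \<noteq> 0"
  shows "is_frame (scl p u + scl q v) (scl r u + scl s v)"
  unfolding is_frame_def comb_comb
proof (intro conjI allI impI)
  fix w
  obtain a b where w: "w = scl a u + scl b v"
    using uv unfolding is_frame_def by blast
  \<comment> \<open>Cramer's rule for \<open>x * p + y * r = a\<close>,
    \<open>x * q + y * s = b\<close>.\<close>
  define x y where "x = (a * s - b * r) / (p * s - q * r)"
    and "y = (b * p - a * q) / (p * s - q * r)"
  have "x * p + y * r = ((a * s - b * r) * p + (b * p - a * q) * r) / (p * s - q * r)"
    by (simp add: x_def y_def add_divide_distrib)
  also have "(a * s - b * r) * p + (b * p - a * q) * r = a * (p * s - q * r)"
    by algebra
  finally have 1: "x * p + y * r = a" using det by simp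
  have "x * q + y * s = ((a * s - b * r) * q + (b * p - a * q) * s) / (p * s - q * r)"
    by (simp add: x_def y_def add_divide_distrib)
  also have "(a * s - b * r) * q + (b * p - a * q) * s = b * (p * s - q * r)"
    by algebra
  finally have 2: "x * q + y * s = b" using det by simp
  show "\<exists>x y. w = scl (x * p + y * r) u + scl (x * q + y * s) v"
    using 1 2 w by metis
next
  fix x y
  assume "scl (x * p + y * r) u + scl (x * q + y * s) v = 0"
  then have 0: "x * p + y * r = 0" "x * q + y * s = 0"
    using uv unfolding is_frame_def by blast+
  \<comment> \<open>Eliminating one unknown leaves the other times the determinant.\<close>
  then have "x * (p * s - q * r) = 0" "y * (p * s - q * r) = 0"
    by algebra+
  with det show "x = 0" "y = 0" by simp_all
qed

text \<open>The coordinate map \<open>g\<close> from \<open>'k ^ 2\<close> is multiplicative by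
  bilinearity, since it is so on basis vectors. The required isomorphism goes the other way, so it
  is \<open>inv g\<close>.\<close>

lemma isomorphic_table_mult:
  assumes uv: "is_frame u v"
    and "\<mu> u u = scl (e11 $ 1) u + scl (e11 $ 2) v"
    and "\<mu> u v = scl (e12 $ 1) u + scl (e12 $ 2) v"
    and "\<mu> v u = scl (e21 $ 1) u + scl (e21 $ 2) v"
    and "\<mu> v v = scl (e22 $ 1) u + scl (e22 $ 2) v"
  shows "nonassoc_algebra_isomorphic scl \<mu> (*s) (table_mult e11 e12 e21 e22)"
proof -
  define g :: "'k ^ 2 \<Rightarrow> 'v" where "g x = scl (x $ 1) u + scl (x $ 2) v" for x
  have add: "g (x + y) = g x + g y" and scale: "g (c *s x) = scl c (g x)" for x y c
    by (simp_all add: g_def algebra_simps)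
  have mult: "g (table_mult e11 e12 e21 e22 x y) = \<mu> (g x) (g y)" for x y
    using assms(2-) by (simp add: g_def table_mult_def mult_bilinear algebra_simps)
  have "bij g"
  proof (rule bijI)
    show "inj g"
    proof (rule injI)
      fix x y assume "g x = g y"
      then have "scl (x $ 1 - y $ 1) u + scl (x $ 2 - y $ 2) v = 0"
        by (simp add: g_def algebra_simps)
      then show "x = y"
        using uv by (force simp: is_frame_def vec_eq_iff forall_2)
    qed
    have "\<exists>x. w = g x" for w
    proof -
      obtain a b where "w = scl a u + scl b v"
        using uv unfolding is_frame_def by blast
      then have "w = g (vector [a, b])" by (simp add: g_def)
      then show ?thesis ..
    qed
    then show "surj g" by (simp add: surj_def)
  qed
  then have inv: "inv g (g x) = x" "g (inv g w) = w" "bij (inv g)" for x w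
    by (simp_all add: bij_is_inj bij_is_surj surj_f_inv_f bij_imp_bij_inv)
  have "inv g (a + b) = inv g a + inv g b" "inv g (scl c a) = c *s inv g a"
    "inv g (\<mu> a b) = table_mult e11 e12 e21 e22 (inv g a) (inv g b)" for a b c
    by (metis add inv(1,2)) (metis scale inv(1,2), metis mult inv(1,2))
  moreover from this have "Vector_Spaces.linear scl (*s) (inv g)"
    by unfold_locales (simp_all add: algebra_simps vec_eq_iff)
  ultimately show ?thesis
    using inv unfolding nonassoc_algebra_isomorphic_def by blast
qed

section \<open>Bases with commutator \<open>2u\<close>\<close>

text \<open>The summands \<open>+ 1\<close> and \<open>- 1\<close> encode
  \<open>uv - vu = 2u\<close>; \<open>\<alpha>2\<close>, \<open>\<beta>2\<close> are then the
  coordinates of the symmetrised product \<open>(uv + vu) / 2\<close>.\<close>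

definition is_normal_frame :: "'v \<Rightarrow> 'v \<Rightarrow> 'k \<Rightarrow> 'k \<Rightarrow> 'k \<Rightarrow> 'k \<Rightarrow> 'k \<Rightarrow> 'k \<Rightarrow> bool" where
  "is_normal_frame u v \<alpha>1 \<beta>1 \<alpha>2 \<beta>2 \<alpha>4 \<beta>4 \<longleftrightarrow> is_frame u v \<and>
     \<mu> u u = scl \<alpha>1 u + scl \<beta>1 v \<and>
     \<mu> u v = scl (\<alpha>2 + 1) u + scl \<beta>2 v \<and>
     \<mu> v u = scl (\<alpha>2 - 1) u + scl \<beta>2 v \<and>
     \<mu> v v = scl \<alpha>4 u + scl \<beta>4 v"

lemma normal_frame_exists:
  assumes two: "(2 :: 'k) \<noteq> 0" and dim: "dim UNIV = 2"
    and noncomm: "\<not> (\<forall>x y. \<mu> x y = \<mu> y x)"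
  obtains u v \<alpha>1 \<beta>1 \<alpha>2 \<beta>2 \<alpha>4 \<beta>4 where "is_normal_frame u v \<alpha>1 \<beta>1 \<alpha>2 \<beta>2 \<alpha>4 \<beta>4"
proof -
  obtain x y where xy: "is_frame x y" using frame_exists[OF dim] .
  define comm where "comm a b = \<mu> a b - \<mu> b a" for a b
  \<comment> \<open>An alternating bilinear map on a plane is the determinant times its value on a
    basis. So all commutators are multiples of \<open>comm x y\<close>, which cannot vanish.\<close>
  have comm: "comm (scl p x + scl q y) (scl r x + scl s y) = scl (p * s - q * r) (comm x y)"
    for p q r s
    by (simp add: comm_def mult_bilinear algebra_simps)
  have "comm x y \<noteq> 0"
  proof
    assume "comm x y = 0"
    have "\<mu> a b = \<mu> b a" for a b
    proof -
      obtain p q r s where "a = scl p x + scl q y" "b = scl r x + scl s y"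
        using xy unfolding is_frame_def by metis
      with comm[of p q r s] \<open>comm x y = 0\<close> show ?thesis
        by (simp add: comm_def)
    qed
    with noncomm show False by blast
  qed
  obtain p q where pq: "comm x y = scl p x + scl q y"
    using xy unfolding is_frame_def by blast
  with \<open>comm x y \<noteq> 0\<close> have "p \<noteq> 0 \<or> q \<noteq> 0" by auto
  \<comment> \<open>Determinant 2 will give \<open>comm u v = 2u\<close>. One of \<open>r\<close>,
    \<open>s\<close> can be 0; the instantiations below list \<open>s\<close> before
    \<open>r\<close>.\<close>
  then obtain r s where det: "p * s - q * r = 2"
  proof
    assume "p \<noteq> 0"
    then show thesis using that[of "2 / p" 0] by simp
  next
    assume "q \<noteq> 0"
    then show thesis using that[of 0 "- 2 / q"] by simp
  qed
  define u v where "u = comm x y" and "v = scl r x + scl s y"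
  have uv: "is_frame u v"
    unfolding u_def v_def pq using frame_change[OF xy] det two by metis
  have "comm u v = scl 2 u"
    using comm[of p q r s] unfolding u_def v_def pq det .
  \<comment> \<open>Here \<open>\<alpha>2\<close> is the \<open>u\<close>-coordinate of
    \<open>vu\<close>, so the parameter of the normal frame is \<open>\<alpha>2 + 1\<close>.\<close>
  obtain \<alpha>1 \<beta>1 \<alpha>2 \<beta>2 \<alpha>4 \<beta>4 where *: "\<mu> u u = scl \<alpha>1 u + scl \<beta>1 v"
      "\<mu> v u = scl \<alpha>2 u + scl \<beta>2 v" "\<mu> v v = scl \<alpha>4 u + scl \<beta>4 v"
    using uv unfolding is_frame_def by metis
  have "\<mu> u v = scl 2 u + \<mu> v u"
    using \<open>comm u v = scl 2 u\<close> by (simp add: comm_def algebra_simps)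
  also have "\<dots> = scl ((\<alpha>2 + 1) + 1) u + scl \<beta>2 v"
    by (simp add: * flip: scale_left_distrib add.assoc) 
  finally have "is_normal_frame u v \<alpha>1 \<beta>1 (\<alpha>2 + 1) \<beta>2 \<alpha>4 \<beta>4"
    using uv * by (simp add: is_normal_frame_def)
  then show thesis by (rule that)
qed

text \<open>With \<open>u' = au\<close> and \<open>v' = v + bu\<close>, a vector
  \<open>xu + yv\<close> equals \<open>((x - by) / a) u' + y v'\<close>; applied to the four
  products this yields the new parameters. If \<open>\<beta>1\<close> is nonzero, only its class
  modulo squares is intrinsic.\<close>

lemma normal_frame_change:
  assumes uv: "is_normal_frame u v \<alpha>1 \<beta>1 \<alpha>2 \<beta>2 \<alpha>4 \<beta>4" and a: "a \<noteq> 0"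
  shows "is_normal_frame (scl a u) (v + scl b u)
    (a * (\<alpha>1 - b * \<beta>1)) (a\<^sup>2 * \<beta>1)
    (\<alpha>2 + b * \<alpha>1 - b * \<beta>2 - b\<^sup>2 * \<beta>1) (a * (\<beta>2 + b * \<beta>1))
    ((\<alpha>4 + 2 * b * \<alpha>2 + b\<^sup>2 * \<alpha>1 - b * (\<beta>4 + 2 * b * \<beta>2 + b\<^sup>2 * \<beta>1)) / a)
    (\<beta>4 + 2 * b * \<beta>2 + b\<^sup>2 * \<beta>1)"
proof -
  have frame: "is_frame (scl a u) (v + scl b u)"
    using frame_change[of u v a 1 0 b] uv a
    by (simp add: is_normal_frame_def add.commute)
  \<comment> \<open>Both sides of each table entry are expanded in the old basis, where matching
    coordinates suffices.\<close>
  have new: "scl x (scl a u) + scl y (v + scl b u) = scl (x * a + y * b) u + scl y v" for x y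
    by (simp add: algebra_simps)
  have table: "\<mu> u u = scl \<alpha>1 u + scl \<beta>1 v" "\<mu> u v = scl (\<alpha>2 + 1) u + scl \<beta>2 v"
      "\<mu> v u = scl (\<alpha>2 - 1) u + scl \<beta>2 v" "\<mu> v v = scl \<alpha>4 u + scl \<beta>4 v"
    using uv unfolding is_normal_frame_def by blast+
  have product: "\<mu> (scl p u + scl q v) (scl r u + scl s v) =
      scl (p * r * \<alpha>1 + p * s * (\<alpha>2 + 1) + q * r * (\<alpha>2 - 1) + q * s * \<alpha>4) u +
      scl (p * r * \<beta>1 + p * s * \<beta>2 + q * r * \<beta>2 + q * s * \<beta>4) v" for p q r s
    by (simp add: table mult_bilinear algebra_simps)
  have products:
    "\<mu> (scl a u) (scl a u) = scl (a * a * \<alpha>1) u + scl (a * a * \<beta>1) v"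
    "\<mu> (scl a u) (v + scl b u) =
       scl (a * b * \<alpha>1 + a * (\<alpha>2 + 1)) u + scl (a * b * \<beta>1 + a * \<beta>2) v"
    "\<mu> (v + scl b u) (scl a u) =
       scl (b * a * \<alpha>1 + a * (\<alpha>2 - 1)) u + scl (b * a * \<beta>1 + a * \<beta>2) v"
    "\<mu> (v + scl b u) (v + scl b u) =
       scl (b * b * \<alpha>1 + b * (\<alpha>2 + 1) + b * (\<alpha>2 - 1) + \<alpha>4) u +
       scl (b * b * \<beta>1 + b * \<beta>2 + b * \<beta>2 + \<beta>4) v"
    using product[of a 0 a 0] product[of a 0 b 1] product[of b 1 a 0] product[of b 1 b 1]
    by (simp_all add: add.commute[of v])
  have eqI: "scl p u + scl q v = scl p' u + scl q' v" if "p = p'" "q = q'" for p q p' q'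
    using that by simp
  show ?thesis
    unfolding is_normal_frame_def new products
    by (intro conjI frame eqI)
      (use a in simp_all, simp_all add: algebra_simps power2_eq_square)
qed

lemma normal_frame_isomorphic:
  assumes "is_normal_frame u v \<alpha>1 \<beta>1 \<alpha>2 \<beta>2 \<alpha>4 \<beta>4"
  shows "nonassoc_algebra_isomorphic scl \<mu> (*s)
    (table_mult (\<alpha>1 *s e1 + \<beta>1 *s e2) ((\<alpha>2 + 1) *s e1 + \<beta>2 *s e2)
       ((\<alpha>2 - 1) *s e1 + \<beta>2 *s e2) (\<alpha>4 *s e1 + \<beta>4 *s e2))"
  using assms unfolding is_normal_frame_def
  by (intro isomorphic_table_mult[of u v]) (simp_all add: axis_def)

text \<open>The parameters are tested in the order \<open>\<beta>1\<close>, \<open>\<beta>2\<close>,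
  \<open>\<alpha>1\<close>, \<open>\<beta>4 - 2 * \<alpha>2\<close>, \<open>\<alpha>4\<close>: once
  the earlier ones vanish, the next is merely scaled by a base change, so its vanishing is
  intrinsic. The factor \<open>a\<close> is left open so that each field hypothesis can normalise
  \<open>\<beta>1\<close> in its own way.\<close>

lemma normal_frame_cases:
  assumes two: "(2 :: 'k) \<noteq> 0" and uv: "is_normal_frame u v \<alpha>1 \<beta>1 \<alpha>2 \<beta>2 \<alpha>4 \<beta>4"
    and a: "\<beta>1 \<noteq> 0 \<Longrightarrow> a \<noteq> 0"
  shows "\<beta>1 \<noteq> 0 \<and> (\<exists>\<alpha>2 \<beta>2 \<alpha>4 \<beta>4.
       nonassoc_algebra_isomorphic scl \<mu> (*s) (phi1 (a\<^sup>2 * \<beta>1) \<alpha>2 \<beta>2 \<alpha>4 \<beta>4)) \<or>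
    (\<exists>\<alpha>1 \<alpha>2 \<alpha>4. nonassoc_algebra_isomorphic scl \<mu> (*s) (mu2 \<alpha>1 \<alpha>2 \<alpha>4)) \<or>
    (\<exists>\<alpha>4 \<beta>4. nonassoc_algebra_isomorphic scl \<mu> (*s) (mu3 \<alpha>4 \<beta>4)) \<or>
    (\<exists>\<alpha>2 \<beta>4. nonassoc_algebra_isomorphic scl \<mu> (*s) (mu4 \<alpha>2 \<beta>4)) \<or>
    (\<exists>\<alpha>2. nonassoc_algebra_isomorphic scl \<mu> (*s) (mu5 \<alpha>2))"
proof -
  consider "\<beta>1 \<noteq> 0" | "\<beta>1 = 0" "\<beta>2 \<noteq> 0" | "\<beta>1 = 0" "\<beta>2 = 0" "\<alpha>1 \<noteq> 0"
    | "\<beta>1 = 0" "\<beta>2 = 0" "\<alpha>1 = 0" "\<beta>4 \<noteq> 2 * \<alpha>2"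
    | "\<beta>1 = 0" "\<beta>2 = 0" "\<alpha>1 = 0" "\<beta>4 = 2 * \<alpha>2" "\<alpha>4 = 0"
    | "\<beta>1 = 0" "\<beta>2 = 0" "\<alpha>1 = 0" "\<beta>4 = 2 * \<alpha>2" "\<alpha>4 \<noteq> 0"
    by blast
  then show ?thesis
  proof cases
    case 1
    \<comment> \<open>The shift \<open>b = \<alpha>1 / \<beta>1\<close> removes the
      \<open>u\<close>-part of \<open>uu\<close>.\<close>
    obtain u' v' \<alpha>2' \<beta>2' \<alpha>4' \<beta>4' where "is_normal_frame u' v' 0 (a\<^sup>2 * \<beta>1) \<alpha>2' \<beta>2' \<alpha>4' \<beta>4'"
      using normal_frame_change[OF uv, of a "\<alpha>1 / \<beta>1"] 1 a by auto
    from normal_frame_isomorphic[OF this]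
    have "nonassoc_algebra_isomorphic scl \<mu> (*s) (phi1 (a\<^sup>2 * \<beta>1) \<alpha>2' \<beta>2' \<alpha>4' \<beta>4')"
      by (simp add: phi1_def)
    with 1 show ?thesis by blast
  next
    case 2
    \<comment> \<open>With \<open>\<beta>1 = 0\<close> the new \<open>\<beta>4\<close> is affine in
      \<open>b\<close> with slope \<open>2 * \<beta>2\<close>, nonzero since 2 is; \<open>b\<close>
      is its root, and \<open>a = 1 / \<beta>2\<close> scales \<open>\<beta>2\<close> to 1.\<close>
    then have "\<beta>4 + 2 * (- (\<beta>4 / (2 * \<beta>2))) * \<beta>2 = 0"
      using two by simp
    moreover note 2
    ultimately
    obtain u' v' \<alpha>1' \<alpha>2' \<alpha>4' where "is_normal_frame u' v' \<alpha>1' 0 \<alpha>2' 1 \<alpha>4' 0"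
      using normal_frame_change[OF uv, of "1 / \<beta>2" "- (\<beta>4 / (2 * \<beta>2))"] by auto
    from normal_frame_isomorphic[OF this]
    have "nonassoc_algebra_isomorphic scl \<mu> (*s) (mu2 \<alpha>1' \<alpha>2' \<alpha>4')"
      by (simp add: mu2_def)
    then show ?thesis by blast
  next
    case 3
    \<comment> \<open>Now \<open>\<alpha>2\<close> becomes \<open>\<alpha>2 + b * \<alpha>1\<close>,
      which \<open>b\<close> sends to 0, while \<open>a\<close> scales \<open>\<alpha>1\<close> to
      1.\<close>
    obtain u' v' \<alpha>4' \<beta>4' where "is_normal_frame u' v' 1 0 0 0 \<alpha>4' \<beta>4'"
      using normal_frame_change[OF uv, of "1 / \<alpha>1" "- (\<alpha>2 / \<alpha>1)"] 3 by auto
    from normal_frame_isomorphic[OF this]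
    have "nonassoc_algebra_isomorphic scl \<mu> (*s) (mu3 \<alpha>4' \<beta>4')"
      by (simp add: mu3_def)
    then show ?thesis by blast
  next
    case 4
    \<comment> \<open>Only \<open>\<alpha>4\<close> still changes; this \<open>b\<close> removes
      it.\<close>
    then have "\<alpha>4 + 2 * (\<alpha>4 / (\<beta>4 - 2 * \<alpha>2)) * \<alpha>2 - \<alpha>4 / (\<beta>4 - 2 * \<alpha>2) * \<beta>4 = 0"
      by (simp add: field_simps)
    moreover note 4
    ultimately
    obtain u' v' \<alpha>2' \<beta>4' where "is_normal_frame u' v' 0 0 \<alpha>2' 0 0 \<beta>4'"
      using normal_frame_change[OF uv, of 1 "\<alpha>4 / (\<beta>4 - 2 * \<alpha>2)"] by auto
    from normal_frame_isomorphic[OF this]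
    have "nonassoc_algebra_isomorphic scl \<mu> (*s) (mu4 \<alpha>2' \<beta>4')"
      by (simp add: mu4_def)
    then show ?thesis by blast
  next
    case 5
    with normal_frame_isomorphic[OF uv]
    have "nonassoc_algebra_isomorphic scl \<mu> (*s) (mu4 \<alpha>2 \<beta>4)"
      by (simp add: mu4_def)
    then show ?thesis by blast
  next
    case 6
    \<comment> \<open>Since \<open>\<beta>4 = 2 * \<alpha>2\<close>, shifts by \<open>b\<close>
      leave \<open>\<alpha>4\<close> fixed; it can only be scaled, here to 1.\<close>
    with normal_frame_isomorphic[OF normal_frame_change[OF uv, of \<alpha>4 0]]
    have "nonassoc_algebra_isomorphic scl \<mu> (*s) (mu5 \<alpha>2)"
      by (simp add: mu5_def)
    then show ?thesis by blast
  qed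
qed

end

section \<open>Squares in the base field\<close>

text \<open>Supplies the factor \<open>a\<close> by which \<open>u\<close> is rescaled to bring
  \<open>\<beta>1\<close> into \<open>R\<close>.\<close>

lemma square_orbit_representativeE:
  assumes "square_orbit_representatives R"
  obtains a where "a \<noteq> 0" "a\<^sup>2 * x \<in> R"
proof -
  obtain r where "r \<in> R" "r \<in> square_orbit x"
    using assms unfolding square_orbit_representatives_def by (meson rangeI)
  then show thesis using that by (auto simp: square_orbit_def)
qed

lemma algebraically_closed_type_inverse_square:
  fixes x :: "'k::field"
  assumes "algebraically_closed_type TYPE('k)" and "x \<noteq> 0"
  obtains a where "a \<noteq> 0" "a\<^sup>2 * x = 1"
proof -
  \<comment> \<open>Coefficients start with the constant term: this is
    \<open>x * X^2 - 1\<close>.\<close>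
  have "degree [:- 1, 0, x:] > 0" using \<open>x \<noteq> 0\<close> by simp
  then obtain a where "poly [:- 1, 0, x:] a = 0"
    using assms(1) unfolding algebraically_closed_type_def by blast
  then have "a\<^sup>2 * x = 1" by (simp add: power2_eq_square mult.assoc)
  moreover from this have "a \<noteq> 0" by auto
  ultimately show thesis by (rule that[rotated])
qed

theorem theorem2:
  fixes scl :: "'k::field \<Rightarrow> 'v::ab_group_add \<Rightarrow> 'v"
    and \<mu> :: "'v \<Rightarrow> 'v \<Rightarrow> 'v"
  assumes char: "CHAR('k) \<noteq> 2"
    and algebra: "nonassoc_algebra scl \<mu>"
    and dim: "vector_space.dim scl (UNIV :: 'v set) = 2"
    and noncomm: "\<not> (\<forall>x y. \<mu> x y = \<mu> y x)"
  shows
    "(algebraically_closed_type TYPE('k) \<longrightarrow>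
        (\<exists>\<alpha>2 \<beta>2 \<alpha>4 \<beta>4. nonassoc_algebra_isomorphic scl \<mu> (*s) (mu1 \<alpha>2 \<beta>2 \<alpha>4 \<beta>4)) \<or>
        (\<exists>\<alpha>1 \<alpha>2 \<alpha>4. nonassoc_algebra_isomorphic scl \<mu> (*s) (mu2 \<alpha>1 \<alpha>2 \<alpha>4)) \<or>
        (\<exists>\<alpha>4 \<beta>4. nonassoc_algebra_isomorphic scl \<mu> (*s) (mu3 \<alpha>4 \<beta>4)) \<or>
        (\<exists>\<alpha>2 \<beta>4. nonassoc_algebra_isomorphic scl \<mu> (*s) (mu4 \<alpha>2 \<beta>4)) \<or>
        (\<exists>\<alpha>2. nonassoc_algebra_isomorphic scl \<mu> (*s) (mu5 \<alpha>2))) \<and>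
     (\<not> algebraically_closed_type TYPE('k) \<longrightarrow>
        (\<forall>R. square_orbit_representatives R \<longrightarrow>
          (\<exists>\<alpha>1 \<alpha>2 \<alpha>4. nonassoc_algebra_isomorphic scl \<mu> (*s) (mu2 \<alpha>1 \<alpha>2 \<alpha>4)) \<or>
          (\<exists>\<alpha>4 \<beta>4. nonassoc_algebra_isomorphic scl \<mu> (*s) (mu3 \<alpha>4 \<beta>4)) \<or>
          (\<exists>\<alpha>2 \<beta>4. nonassoc_algebra_isomorphic scl \<mu> (*s) (mu4 \<alpha>2 \<beta>4)) \<or>
          (\<exists>\<alpha>2. nonassoc_algebra_isomorphic scl \<mu> (*s) (mu5 \<alpha>2)) \<or>
          (\<exists>lam\<in>R. \<exists>\<alpha>2 \<beta>2 \<alpha>4 \<beta>4.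
             nonassoc_algebra_isomorphic scl \<mu> (*s) (phi1 lam \<alpha>2 \<beta>2 \<alpha>4 \<beta>4))))"
proof -
  interpret nonassoc_algebra scl \<mu> by fact
  have two: "(2 :: 'k) \<noteq> 0"
  proof
    assume "(2 :: 'k) = 0"
    then have "of_nat 2 = (0 :: 'k)" by simp
    then have "CHAR('k) dvd 2" by (simp only: of_nat_eq_0_iff_char_dvd)
    \<comment> \<open>The characteristic divides the prime 2 and is not 2; the value 1 would force
      \<open>1 = 0\<close>.\<close>
    with char have "CHAR('k) = 1"
      using two_is_prime_nat unfolding prime_nat_iff by blast
    then show False by simp
  qed
  obtain u v \<alpha>1 \<beta>1 \<alpha>2 \<beta>2 \<alpha>4 \<beta>4 where uv: "is_normal_frame u v \<alpha>1 \<beta>1 \<alpha>2 \<beta>2 \<alpha>4 \<beta>4"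
    using normal_frame_exists[OF two dim noncomm] .
  note cases = normal_frame_cases[OF two uv]
  show ?thesis (is "(_ \<longrightarrow> ?closed) \<and> (_ \<longrightarrow> (\<forall>R. _ R \<longrightarrow> ?general R))")
  proof (intro conjI impI allI)
    assume "algebraically_closed_type TYPE('k)"
    \<comment> \<open>The implication lets one \<open>a\<close> serve both cases: if
      \<open>\<beta>1 = 0\<close>, any value will do. Otherwise \<open>\<beta>1\<close> is scaled to
      1, where \<open>phi1\<close> becomes \<open>mu1\<close>.\<close>
    then obtain a :: 'k where "\<beta>1 \<noteq> 0 \<Longrightarrow> a \<noteq> 0 \<and> a\<^sup>2 * \<beta>1 = 1"
      using algebraically_closed_type_inverse_square by metis
    moreover have "phi1 1 = (mu1 :: 'k \<Rightarrow> _)"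
      by (simp add: fun_eq_iff phi1_def mu1_def)
    ultimately show ?closed using cases[of a] by auto
  next
    fix R :: "'k set"
    assume "square_orbit_representatives R"
    then obtain a where "a \<noteq> 0" "a\<^sup>2 * \<beta>1 \<in> R"
      by (rule square_orbit_representativeE)
    then show "?general R" using cases[of a] by blast
  qed
qed

end
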